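(* Let $n\ge 1$ and let $x,y\in\mathbb{F}^n$ be vectors of floating-point numbers such that $x_i y_i>0$ for every $1\le i\le n$. Let $\rho\in\{\rho_{RU},\rho_{RD},\rho_{RZ},\rho_{RN}\}$ be a rounding function with unit roundoff $u$, $0<u<1$. Let $s=\sum_{i=1}^{n}x_i y_i$ be the inner product of $x$ and $y$ computed in infinite precision, and let $\tilde s=\tilde s_n$ be the inner product computed in floating-point arithmetic, where $\tilde s_1=\rho(x_1y_1)$ and $\tilde s_{k+1}=\rho(\tilde s_k+\rho(x_{k+1}y_{k+1}))$ for $1\le k<n$. Then $$s\sim\tilde s\,;\,\mathrm{rp}\left(\frac{nu}{1-u}\right).$$
   Context: For $a,\tilde a,\alpha\in\mathbb{R}$, the notation $a\sim\tilde a\,;\,\mathrm{rp}(\alpha)$ ("$\tilde a$ is an approximation to $a$ of relative precision $\alpha$") means: $\alpha\ge 0$, $a$ and $\tilde a$ are nonzero and have the same sign, and $|\ln(\tilde a/a)|\le\alpha$. Fix a precision $p$ (a positive integer). No underflow or overflow is assumed to occur, which is modelled by taking the binary floating-point numbers of precision $p$ with unbounded exponent range: $\mathbb{F}=\{m\cdot 2^{e} : m,e\in\mathbb{Z},\ |m|<2^{p}\}\subset\mathbb{R}$ (no NaN or infinities). The rounding functions $\rho:\mathbb{R}\to\mathbb{F}$ are: $\rho_{RU}(a)=\min\{b\in\mathbb{F}: b\ge a\}$ (towards $+\infty$); $\rho_{RD}(a)=\max\{b\in\mathbb{F}: b\le a\}$ (towards $-\infty$); $\rho_{RZ}(a)=\rho_{RU}(a)$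 if $a<0$ and $\rho_{RD}(a)$ otherwise (towards zero); $\rho_{RN}(a)$ is an element $b\in\mathbb{F}$ with $|a-b|\le|a-c|$ for all $c\in\mathbb{F}$ (to nearest, with arbitrary tie breaking). The unit roundoff is $u=2^{1-p}$ for $\rho_{RU},\rho_{RD},\rho_{RZ}$ and $u=2^{-p}$ for $\rho_{RN}$. *)

theory Defs
  imports Complex_Main
begin

definition approx_rp :: "real \<Rightarrow> real \<Rightarrow> real \<Rightarrow> bool"
    (\<open>(_ \<sim> _ ; rp'(_'))\<close> [51, 51, 0] 50) where
  "a \<sim> a' ; rp(\<alpha>) \<longleftrightarrow>
     0 \<le> \<alpha> \<and> a \<noteq> 0 \<and> a' \<noteq> 0 \<and> sgn a = sgn a' \<and> \<bar>ln (a' / a)\<bar> \<le> \<alpha>"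

definition floats :: "nat \<Rightarrow> real set" where
  "floats p = {of_int m * 2 powi e | m e :: int. \<bar>m\<bar> < 2 ^ p}"

text \<open>The minimum and maximum below range over infinite sets, hence \<open>LEAST\<close> and
  \<open>GREATEST\<close> instead of \<open>Min\<close> and \<open>Max\<close>.\<close>

definition round_up :: "nat \<Rightarrow> real \<Rightarrow> real" where
  "round_up p a = (LEAST b. b \<in> floats p \<and> a \<le> b)"

definition round_down :: "nat \<Rightarrow> real \<Rightarrow> real" where
  "round_down p a = (GREATEST b. b \<in> floats p \<and> b \<le> a)"

definition round_zero :: "nat \<Rightarrow> real \<Rightarrow> real" where
  "round_zero p a = (if a < 0 then round_up p a else round_down p a)"

text \<open>Rounding to nearest is a property of \<open>\<rho>\<close> rather than a single function because the
  tie-breaking rule is arbitrary.\<close>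

definition is_round_nearest :: "nat \<Rightarrow> (real \<Rightarrow> real) \<Rightarrow> bool" where
  "is_round_nearest p \<rho> \<longleftrightarrow>
     (\<forall>a. \<rho> a \<in> floats p \<and> (\<forall>c\<in>floats p. \<bar>a - \<rho> a\<bar> \<le> \<bar>a - c\<bar>))"

datatype rounding_mode = RU | RD | RZ | RN

fun is_rounding :: "nat \<Rightarrow> rounding_mode \<Rightarrow> (real \<Rightarrow> real) \<Rightarrow> bool" where
  "is_rounding p RU \<rho> \<longleftrightarrow> \<rho> = round_up p"
| "is_rounding p RD \<rho> \<longleftrightarrow> \<rho> = round_down p"
| "is_rounding p RZ \<rho> \<longleftrightarrow> \<rho> = round_zero p"
| "is_rounding p RN \<rho> \<longleftrightarrow> is_round_nearest p \<rho>"

fun unit_roundoff :: "nat \<Rightarrow> rounding_mode \<Rightarrow> real" where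
  "unit_roundoff p RU = 2 powi (1 - int p)"
| "unit_roundoff p RD = 2 powi (1 - int p)"
| "unit_roundoff p RZ = 2 powi (1 - int p)"
| "unit_roundoff p RN = 2 powi (- int p)"

text \<open>Vectors are indexed from 1. The value for the empty vector is a dummy: the recursion starts
  at length 1, so that the first product is rounded only once.\<close>

fun fl_inner :: "(real \<Rightarrow> real) \<Rightarrow> (nat \<Rightarrow> real) \<Rightarrow> (nat \<Rightarrow> real) \<Rightarrow> nat \<Rightarrow> real" where
  "fl_inner \<rho> x y 0 = 0"
| "fl_inner \<rho> x y (Suc 0) = \<rho> (x 1 * y 1)"
| "fl_inner \<rho> x y (Suc (Suc k)) =
     \<rho> (fl_inner \<rho> x y (Suc k) + \<rho> (x (Suc (Suc k)) * y (Suc (Suc k))))"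

end

theory Submission
  imports Defs
begin

text \<open>
  Relative precision is additive along a chain of approximations, since the logarithms of the
  successive ratios add up, and for positive numbers it is inherited by sums: if both \<open>a'/a\<close> and
  \<open>b'/b\<close> lie in \<open>[exp (-\<alpha>), exp \<alpha>]\<close>, then so does \<open>(a' + b')/(a + b)\<close>. In the computed inner
  product of positive terms, the first product passes through \<open>n\<close> roundings, itself and \<open>n - 1\<close>
  additions, and every other product through at most as many. Nothing cancels, so the result has
  relative precision \<open>n \<delta>\<close> as soon as each single rounding has relative precision \<open>\<delta>\<close>.

  A single rounding of \<open>a > 0\<close> commits an error of at most \<open>u a\<close>. Indeed, if \<open>2\<^sup>e \<le> a < 2\<^sup>e\<^sup>+\<^sup>1\<close>, then
  the floating-point numbers around \<open>a\<close> are the multiples of \<open>2\<^sup>e\<^sup>+\<^sup>1\<^sup>-\<^sup>p\<close>, a spacing of at most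
  \<open>2\<^sup>1\<^sup>-\<^sup>p a\<close>; directed roundings err by at most this spacing, rounding to nearest by at most half of
  it. So the ratio of the rounded to the exact value lies in \<open>[1 - u, 1 + u]\<close>. The lower end of this
  interval is the worse one for the logarithm, and \<open>- ln (1 - u) = ln (1 + u/(1 - u)) \<le> u/(1 - u)\<close>
  gives \<open>\<delta> = u/(1 - u)\<close>.

  Negative factors \<open>x\<^sub>i, y\<^sub>i\<close> do no harm: only the products and the running computed sums
  are ever rounded, and all of these are positive.
\<close>

section \<open>Calculus of relative precision on positive numbers\<close>

text \<open>Clearing the logarithm and the quotient turns the relation into two linear inequalities,
  from which its compatibility with composition and addition can be read off.\<close>

lemma approx_rp_pos_iff:
  assumes "0 < a"
  shows "a \<sim> b ; rp(\<alpha>) \<longleftrightarrow> 0 \<le> \<alpha> \<and> 0 < b \<and> exp (- \<alpha>) * a \<le> b \<and> b \<le> exp \<alpha> * a"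
proof (cases "0 < b")
  case True
  have "\<bar>ln (b / a)\<bar> \<le> \<alpha> \<longleftrightarrow> - \<alpha> \<le> ln (b / a) \<and> ln (b / a) \<le> \<alpha>"
    by linarith
  also have "\<dots> \<longleftrightarrow> exp (- \<alpha>) \<le> b / a \<and> b / a \<le> exp \<alpha>"
    using assms True by (simp add: ln_ge_iff flip: ln_le_cancel_iff[of _ "exp \<alpha>"])
  also have "\<dots> \<longleftrightarrow> exp (- \<alpha>) * a \<le> b \<and> b \<le> exp \<alpha> * a"
    using assms by (simp add: pos_le_divide_eq pos_divide_le_eq)
  finally show ?thesis
    using assms True by (auto simp: approx_rp_def)
next
  case False
  then show ?thesis
    using assms by (auto simp: approx_rp_def sgn_if split: if_splits)
qed

lemma approx_rp_trans:
  assumes "0 < a" and ab: "a \<sim> b ; rp(\<alpha>)" and bc: "b \<sim> c ; rp(\<beta>)"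
  shows "a \<sim> c ; rp(\<alpha> + \<beta>)"
proof -
  have ab': "0 \<le> \<alpha>" "0 < b" "exp (- \<alpha>) * a \<le> b" "b \<le> exp \<alpha> * a"
    using ab by (simp_all add: approx_rp_pos_iff[OF \<open>0 < a\<close>])
  have bc': "0 \<le> \<beta>" "0 < c" "exp (- \<beta>) * b \<le> c" "c \<le> exp \<beta> * b"
    using bc by (simp_all add: approx_rp_pos_iff[OF \<open>0 < b\<close>])
  have "exp (- (\<alpha> + \<beta>)) * a = exp (- \<beta>) * (exp (- \<alpha>) * a)"
    by (simp flip: exp_add)
  also have "\<dots> \<le> exp (- \<beta>) * b"
    using ab'(3) by simp
  finally have lower: "exp (- (\<alpha> + \<beta>)) * a \<le> c"
    using bc'(3) by simp
  have "exp \<beta> * b \<le> exp \<beta> * (exp \<alpha> * a)"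
    using ab'(4) by simp
  also have "\<dots> = exp (\<alpha> + \<beta>) * a"
    by (simp add: exp_add)
  finally have "c \<le> exp (\<alpha> + \<beta>) * a"
    using bc'(4) by simp
  with lower show ?thesis
    using ab'(1) bc'(1,2) by (simp add: approx_rp_pos_iff[OF \<open>0 < a\<close>])
qed

lemma approx_rp_add:
  assumes "0 < a" "0 < b" "a \<sim> a' ; rp(\<alpha>)" "b \<sim> b' ; rp(\<alpha>)"
  shows "a + b \<sim> a' + b' ; rp(\<alpha>)"
  using assms by (simp add: approx_rp_pos_iff distrib_left add_mono)

lemma approx_rp_mono:
  "a \<sim> b ; rp(\<alpha>) \<Longrightarrow> \<alpha> \<le> \<beta> \<Longrightarrow> a \<sim> b ; rp(\<beta>)"
  by (auto simp: approx_rp_def)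

text \<open>Both bounds follow from \<open>1 + t \<le> exp t\<close> for \<open>t = u/(1 - u)\<close>, because \<open>1 + t = 1/(1 - u)\<close>
  and \<open>u \<le> t\<close>.\<close>

lemma approx_rp_of_relative_error:
  assumes "0 < a" "0 \<le> u" "u < 1" and err: "\<bar>a - b\<bar> \<le> u * a"
  shows "a \<sim> b ; rp(u / (1 - u))"
proof -
  define d where "d = u / (1 - u)"
  have "0 \<le> d"
    using assms by (simp add: d_def)
  have "(1 - u) * (1 + d) = 1"
    using \<open>u < 1\<close> by (simp add: d_def field_simps)
  moreover have "1 + d \<le> exp d"
    by (rule exp_ge_add_one_self)
  ultimately have "1 \<le> (1 - u) * exp d"
    using \<open>u < 1\<close> by (metis diff_gt_0_iff_gt less_eq_real_def mult_left_mono)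
  then have "exp (- d) \<le> 1 - u"
    by (simp add: exp_minus field_simps)
  then have "exp (- d) * a \<le> (1 - u) * a"
    using \<open>0 < a\<close> by simp
  also have "\<dots> \<le> b"
    using err by (simp add: left_diff_distrib)
  finally have lower: "exp (- d) * a \<le> b" .
  moreover have "0 < exp (- d) * a"
    using \<open>0 < a\<close> by simp
  ultimately have "0 < b"
    by linarith
  have "u * (1 - u) \<le> u * 1"
    using assms by (intro mult_left_mono) auto
  then have "u \<le> d"
    using \<open>u < 1\<close> by (simp add: d_def pos_le_divide_eq)
  have "b \<le> (1 + u) * a"
    using err by (simp add: distrib_right)
  also have "\<dots> \<le> exp d * a"
    using \<open>u \<le> d\<close> \<open>1 + d \<le> exp d\<close> \<open>0 < a\<close> by (intro mult_right_mono) linarith+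
  finally show ?thesis
    using lower \<open>0 < b\<close> \<open>0 \<le> d\<close>
    unfolding approx_rp_pos_iff[OF \<open>0 < a\<close>] d_def by blast
qed

section \<open>Floating-point numbers around a positive number\<close>

lemma binade_exists:
  fixes a :: real
  assumes "0 < a"
  obtains e :: int where "2 powi e \<le> a" "a < 2 powi (e + 1)"
proof
  have "2 powr real_of_int \<lfloor>log 2 a\<rfloor> \<le> a"
    using assms by (simp add: powr_le_iff)
  then show "2 powi \<lfloor>log 2 a\<rfloor> \<le> a"
    by (simp add: powr_real_of_int')
  have "a < 2 powr real_of_int (\<lfloor>log 2 a\<rfloor> + 1)"
    using assms by (simp add: less_powr_iff)
  then show "a < 2 powi (\<lfloor>log 2 a\<rfloor> + 1)"
    by (subst (asm) powr_real_of_int') simp_all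
qed

text \<open>The mantissa \<open>2\<^sup>p\<close> is out of range by one, but it can be traded for \<open>2\<^sup>p\<^sup>-\<^sup>1\<close> with the next
  exponent. It occurs when a number is rounded up to the next power of two.\<close>

lemma multiple_in_floats:
  assumes "1 \<le> p" "0 \<le> j" "j \<le> 2 ^ p"
  shows "of_int j * 2 powi k \<in> floats p"
proof (cases "j = 2 ^ p")
  case True
  obtain q where q: "p = Suc q"
    using \<open>1 \<le> p\<close> by (cases p) auto
  have "of_int j * 2 powi k = (of_int (2 ^ q) * 2 powi (k + 1) :: real)"
    by (simp add: True q power_int_add)
  moreover have "\<bar>2 ^ q\<bar> < (2 ^ p :: int)"
    by (simp add: q)
  ultimately show ?thesis
    unfolding floats_def by blast
next
  case False
  then have "\<bar>j\<bar> < 2 ^ p"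
    using assms by simp
  then show ?thesis
    unfolding floats_def by blast
qed

text \<open>A mantissa below \<open>2\<^sup>p\<close> can reach \<open>2\<^sup>e\<close> only if the exponent is at least \<open>e + 1 - p\<close>.\<close>

lemma float_is_multiple:
  assumes "b \<in> floats p" "2 powi e \<le> b"
  obtains j :: int where "b = of_int j * 2 powi (e + 1 - int p)"
proof -
  obtain m k :: int where b: "b = of_int m * 2 powi k" and m: "\<bar>m\<bar> < 2 ^ p"
    using assms(1) by (auto simp: floats_def)
  have "of_int m < (2 ^ p :: real)"
    using m by (metis abs_less_iff of_int_less_iff of_int_numeral of_int_power)
  then have "b < 2 ^ p * 2 powi k"
    by (simp add: b)
  also have "\<dots> = 2 powi (int p + k)"
    by (simp add: power_int_add)
  finally have "(2::real) powi e < 2 powi (int p + k)"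
    using assms(2) by linarith
  then have "e < int p + k"
    by (meson not_less one_le_numeral power_int_increasing)
  then have "e + 1 - int p \<le> k"
    by linarith
  then obtain d where d: "k = (e + 1 - int p) + int d"
    by (meson zle_iff_zadd)
  have "b = of_int (m * 2 ^ d) * 2 powi (e + 1 - int p)"
    by (simp add: b d power_int_add)
  then show ?thesis
    using that by blast
qed

text \<open>The multiples of the spacing next to \<open>a\<close> on either side are floating-point numbers, and
  there are none strictly between them. This also shows that the extrema defining the directed
  roundings are attained.\<close>

lemma directed_roundings_bracket:
  assumes "1 \<le> p" "0 < a"
  shows "round_down p a \<in> floats p" "round_up p a \<in> floats p"
    and "round_down p a \<le> a" "a \<le> round_up p a"
    and "round_up p a - round_down p a \<le> 2 powi (1 - int p) * a"
proof -
  obtain e :: int where e: "2 powi e \<le> a" "a < 2 powi (e + 1)"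
    using binade_exists[OF \<open>0 < a\<close>] .
  define h :: real where "h = 2 powi (e + 1 - int p)"
  have "0 < h"
    by (simp add: h_def)
  define l where "l = \<lfloor>a / h\<rfloor>"
  define c where "c = \<lceil>a / h\<rceil>"
  have top: "2 powi (e + 1) = 2 ^ p * h"
    by (simp add: h_def flip: power_int_add power_int_of_nat)
  have "a / h < 2 ^ p"
    using e(2) \<open>0 < h\<close> by (simp add: top pos_divide_less_eq)
  then have "c \<le> 2 ^ p"
    by (simp add: c_def ceiling_le_iff)
  have "l \<le> c" "c \<le> l + 1"
    unfolding l_def c_def by linarith+
  have "0 \<le> l"
    using \<open>0 < a\<close> \<open>0 < h\<close> by (simp add: l_def)
  have lo: "of_int l * h \<in> floats p" and hi: "of_int c * h \<in> floats p"
    unfolding h_def using \<open>1 \<le> p\<close> \<open>0 \<le> l\<close> \<open>l \<le> c\<close> \<open>c \<le> 2 ^ p\<close>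
    by (auto intro!: multiple_in_floats)
  have la: "of_int l * h \<le> a" and ac: "a \<le> of_int c * h"
    using \<open>0 < h\<close> by (simp_all add: l_def c_def flip: pos_le_divide_eq pos_divide_le_eq)

  (* The power 2^e is itself a multiple of h, hence does not exceed the floor multiple;
     floats below 2^e therefore do not compete with it. *)
  have "2 powi e = of_int (2 ^ (p - 1)) * h"
    using \<open>1 \<le> p\<close> by (simp add: h_def of_nat_diff flip: power_int_add power_int_of_nat)
  then have "of_int (2 ^ (p - 1)) \<le> a / h"
    using e(1) \<open>0 < h\<close> by (simp add: pos_le_divide_eq)
  then have "2 ^ (p - 1) \<le> l"
    unfolding l_def by (rule le_floor_iff[THEN iffD2])
  then have low: "2 powi e \<le> of_int l * h"
    unfolding \<open>2 powi e = of_int (2 ^ (p - 1)) * h\<close> using \<open>0 < h\<close>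
    by (metis less_eq_real_def mult_right_mono of_int_le_iff)
  have rd: "round_down p a = of_int l * h"
    unfolding round_down_def
  proof (rule Greatest_equality)
    show "of_int l * h \<in> floats p \<and> of_int l * h \<le> a"
      using lo la ..
    fix b assume b: "b \<in> floats p \<and> b \<le> a"
    show "b \<le> of_int l * h"
    proof (cases "2 powi e \<le> b")
      case True
      then obtain j :: int where j: "b = of_int j * h"
        using float_is_multiple b unfolding h_def by blast
      then have "of_int j \<le> a / h"
        using b \<open>0 < h\<close> by (simp add: pos_le_divide_eq)
      then show ?thesis
        using \<open>0 < h\<close> by (simp add: j l_def le_floor_iff)
    next
      case False
      with low show ?thesis
        by linarith
    qed
  qed
  have ru: "round_up p a = of_int c * h"
    unfolding round_up_def
  proof (rule Least_equality)
    show "of_int c * h \<in> floats p \<and> a \<le> of_int c * h"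
      using hi ac ..
    fix b assume b: "b \<in> floats p \<and> a \<le> b"
    then obtain j :: int where j: "b = of_int j * h"
      using float_is_multiple e(1) unfolding h_def by (metis order_trans)
    then have "a / h \<le> of_int j"
      using b \<open>0 < h\<close> by (simp add: pos_divide_le_eq)
    then show "of_int c * h \<le> b"
      using \<open>0 < h\<close> by (simp add: j c_def ceiling_le_iff)
  qed
  have "of_int c * h \<le> (of_int l + 1) * h"
    using \<open>c \<le> l + 1\<close> \<open>0 < h\<close> by (intro mult_right_mono) linarith+
  then have "round_up p a - round_down p a \<le> h"
    by (simp add: rd ru distrib_right)
  also have "h = 2 powi (1 - int p) * 2 powi e"
    by (simp add: h_def algebra_simps flip: power_int_add)
  also have "\<dots> \<le> 2 powi (1 - int p) * a"
    using e(1) by simp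
  finally show "round_up p a - round_down p a \<le> 2 powi (1 - int p) * a" .
  show "round_down p a \<in> floats p" "round_up p a \<in> floats p"
    "round_down p a \<le> a" "a \<le> round_up p a"
    using lo hi la ac by (simp_all add: rd ru)
qed

text \<open>Rounding to nearest is at least as good as both directed roundings, hence errs by at most
  half of their distance.\<close>

lemma rounding_relative_error:
  assumes "1 \<le> p" "0 < a" "is_rounding p mode \<rho>"
  shows "\<bar>a - \<rho> a\<bar> \<le> unit_roundoff p mode * a"
proof -
  note bracket = directed_roundings_bracket[OF \<open>1 \<le> p\<close> \<open>0 < a\<close>]
  have directed: "\<bar>a - \<rho> a\<bar> \<le> 2 powi (1 - int p) * a"
    if "\<rho> a = round_down p a \<or> \<rho> a = round_up p a"
  proof -
    have "\<bar>a - \<rho> a\<bar> \<le> round_up p a - round_down p a"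
      using that bracket(3,4) by linarith
    with bracket(5) show ?thesis
      by (rule order_trans[rotated])
  qed
  show ?thesis
  proof (cases mode)
    case RN
    define v where "v = 2 powi (- int p) * a"
    have "2 powi (1 - int p) = (2 * 2 powi (- int p) :: real)"
      by (subst power_int_add_1'[symmetric]) simp_all
    then have "2 powi (1 - int p) * a = 2 * v"
      unfolding v_def by (simp only: mult.assoc)
    with bracket(5) have width: "round_up p a - round_down p a \<le> 2 * v"
      by (simp only:)
    from RN assms(3) have "is_round_nearest p \<rho>"
      by simp
    then have "\<bar>a - \<rho> a\<bar> \<le> \<bar>a - round_down p a\<bar>" "\<bar>a - \<rho> a\<bar> \<le> \<bar>a - round_up p a\<bar>"
      unfolding is_round_nearest_def using bracket(1,2) by blast+
    then have "\<bar>a - \<rho> a\<bar> \<le> a - round_down p a" "\<bar>a - \<rho> a\<bar> \<le> round_up p a - a"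
      using bracket(3,4) by simp_all
    then have "\<bar>a - \<rho> a\<bar> \<le> v"
      using width by linarith
    then show ?thesis
      unfolding RN v_def unit_roundoff.simps .
  next
    case RU
    with assms(3) have "\<rho> a = round_up p a"
      by simp
    then show ?thesis
      unfolding RU unit_roundoff.simps by (intro directed disjI2)
  next
    case RD
    with assms(3) have "\<rho> a = round_down p a"
      by simp
    then show ?thesis
      unfolding RD unit_roundoff.simps by (intro directed disjI1)
  next
    case RZ
    with assms(2,3) have "\<rho> a = round_down p a"
      by (simp add: round_zero_def)
    then show ?thesis
      unfolding RZ unit_roundoff.simps by (intro directed disjI1)
  qed
qed

section \<open>Accumulation over the inner product\<close>

theorem theorem4p1:
  fixes p n :: nat and x y :: "nat \<Rightarrow> real"
    and mode :: rounding_mode and \<rho> :: "real \<Rightarrow> real" and u :: real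
  assumes "p \<ge> 1"
    and "n \<ge> 1"
    and "\<And>i. 1 \<le> i \<Longrightarrow> i \<le> n \<Longrightarrow> x i \<in> floats p"
    and "\<And>i. 1 \<le> i \<Longrightarrow> i \<le> n \<Longrightarrow> y i \<in> floats p"
    and "\<And>i. 1 \<le> i \<Longrightarrow> i \<le> n \<Longrightarrow> x i * y i > 0"
    and "is_rounding p mode \<rho>"
    and "u = unit_roundoff p mode"
    and "0 < u" and "u < 1"
  shows "(\<Sum>i = 1..n. x i * y i) \<sim> fl_inner \<rho> x y n ; rp(real n * u / (1 - u))"
proof -
  define d where "d = u / (1 - u)"
  have "0 \<le> d"
    using assms(8,9) by (simp add: d_def)
  have round: "a \<sim> \<rho> a ; rp(d)" if "0 < a" for a
    unfolding d_def using that assms(1,6-9)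
    by (intro approx_rp_of_relative_error) (auto intro: rounding_relative_error)
  have "(\<Sum>i = 1..n. x i * y i) \<sim> fl_inner \<rho> x y n ; rp(real n * d)"
    using assms(2,5)
  proof (induction n rule: nat_induct_at_least)
    case base
    then show ?case
      using round[of "x 1 * y 1"] by simp
  next
    case (Suc n)
    define s where "s = (\<Sum>i = 1..n. x i * y i)"
    define t where "t = x (Suc n) * y (Suc n)"
    have "0 < s"
      unfolding s_def using Suc.hyps by (intro sum_pos) (auto intro: Suc.prems)
    have "0 < t"
      unfolding t_def by (rule Suc.prems) simp_all
    have s: "s \<sim> fl_inner \<rho> x y n ; rp(real n * d)"
      unfolding s_def by (rule Suc.IH) (simp add: Suc.prems)
    have "1 * d \<le> real n * d"
      using Suc.hyps \<open>0 \<le> d\<close> by (intro mult_right_mono) auto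
    then have "t \<sim> \<rho> t ; rp(real n * d)"
      using round[OF \<open>0 < t\<close>] by (simp add: approx_rp_mono)
    with s have sum: "s + t \<sim> fl_inner \<rho> x y n + \<rho> t ; rp(real n * d)"
      using \<open>0 < s\<close> \<open>0 < t\<close> by (intro approx_rp_add)
    have "0 < s + t"
      using \<open>0 < s\<close> \<open>0 < t\<close> by simp
    then have "0 < fl_inner \<rho> x y n + \<rho> t"
      using sum by (simp add: approx_rp_pos_iff)
    then have "s + t \<sim> \<rho> (fl_inner \<rho> x y n + \<rho> t) ; rp(real n * d + d)"
      by (intro approx_rp_trans[OF \<open>0 < s + t\<close> sum] round)
    moreover have "fl_inner \<rho> x y (Suc n) = \<rho> (fl_inner \<rho> x y n + \<rho> t)"
      using Suc.hyps by (cases n) (simp_all add: t_def)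
    ultimately show ?case
      by (simp add: s_def t_def distrib_right add.commute)
  qed
  then show ?thesis
    by (simp add: d_def)
qed

end
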